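(* Let $G$ be a connected graph (loops and multiple edges allowed) with vertex set $[n]=\{1,\dots,n\}$, and suppose that $e\in E(G)$ is neither a loop nor a bridge in $G$. Then $$P_G(q)=q\,P_{G-e}(q)+P_{G\setminus e}(q).$$
   Context: All graphs are finite. For a connected graph $H$ (loops and multiple edges allowed) whose vertex set $V$ is a finite set of positive integers, the root of $H$ is $r=\max V$. For $I\subseteq V$ and $i\in I$, $\mathrm{outdeg}_I(i)$ is the number of edges of $H$ from $i$ to vertices outside $I$. An $H$-parking function is a function $f:V\to\{-1,0,1,2,\dots\}$ with $f(r)=-1$ such that for every nonempty $I\subseteq V\setminus\{r\}$ there is $i\in I$ with $0\le f(i)<\mathrm{outdeg}_I(i)$. Define $P_H(q)=\sum_f q^{\sum_{i\in V}f(i)}$, summing over all $H$-parking functions $f$ (note that the sum in the exponent includes the root value $-1$). $G-e$ is the graph obtained from $G$ by deleting the edge $e$. If $e$ joins $i$ and $j$ with $i>j$, $G\setminus e$ is the graph obtained from $G$ by contracting $e$, i.e. deleting $e$ and identifying $i$ and $j$ to a single vertex labeled $i$ (so its vertex set is $[n]\setminus\{j\}$ and its root is $n$; other edges between $i$ and $j$ become loops). *)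

theory Defs
  imports
    "HOL-Library.FuncSet"
    "HOL-Library.Uprod"
    "HOL-Computational_Algebra.Formal_Laurent_Series"
begin

text \<open>
  Undirected multigraphs: edges are abstract objects, and \<open>ends\<close> assigns to every edge its
  unordered pair of end vertices, so that parallel edges are possible; a loop at \<open>v\<close> has ends
  \<open>Upair v v\<close>. The values of \<open>ends\<close> outside the edge set are irrelevant.
\<close>

record 'e mgraph =
  verts :: "nat set"
  edges :: "'e set"
  ends :: "'e \<Rightarrow> nat uprod"

definition multigraph :: "'e mgraph \<Rightarrow> bool" where
  "multigraph G \<longleftrightarrow>
     finite (verts G) \<and> (\<forall>v\<in>verts G. 0 < v) \<and> finite (edges G) \<and>
     (\<forall>e\<in>edges G. set_uprod (ends G e) \<subseteq> verts G)"

definition adj_rel :: "'e mgraph \<Rightarrow> (nat \<times> nat) set" where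
  "adj_rel G = {(u, v). \<exists>e\<in>edges G. ends G e = Upair u v}"

definition reach_rel :: "'e mgraph \<Rightarrow> (nat \<times> nat) set" where
  "reach_rel G = (adj_rel G)\<^sup>* \<inter> verts G \<times> verts G"

definition connected_graph :: "'e mgraph \<Rightarrow> bool" where
  "connected_graph G \<longleftrightarrow> verts G \<noteq> {} \<and> (\<forall>u\<in>verts G. \<forall>v\<in>verts G. (u, v) \<in> reach_rel G)"

definition components :: "'e mgraph \<Rightarrow> nat set set" where
  "components G = verts G // reach_rel G"

definition is_loop :: "'e mgraph \<Rightarrow> 'e \<Rightarrow> bool" where
  "is_loop G e \<longleftrightarrow> (\<exists>v. ends G e = Upair v v)"

definition delete_edge :: "'e mgraph \<Rightarrow> 'e \<Rightarrow> 'e mgraph" where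
  "delete_edge G e = G\<lparr>edges := edges G - {e}\<rparr>"

definition is_bridge :: "'e mgraph \<Rightarrow> 'e \<Rightarrow> bool" where
  "is_bridge G e \<longleftrightarrow> e \<in> edges G \<and> card (components G) < card (components (delete_edge G e))"

text \<open>
  If \<open>e\<close> joins \<open>i > j\<close>, then \<open>merge_ends G e\<close> relabels \<open>j\<close> as \<open>i\<close>; contracting \<open>e\<close> removes \<open>e\<close> and
  relabels all vertices and all ends of the remaining edges, so edges parallel to \<open>e\<close> become loops
  at \<open>i\<close>.
\<close>

definition merge_ends :: "'e mgraph \<Rightarrow> 'e \<Rightarrow> nat \<Rightarrow> nat" where
  "merge_ends G e v =
     (if v = Min (set_uprod (ends G e)) then Max (set_uprod (ends G e)) else v)"

definition contract_edge :: "'e mgraph \<Rightarrow> 'e \<Rightarrow> 'e mgraph" where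
  "contract_edge G e =
     \<lparr>verts = merge_ends G e ` verts G,
      edges = edges G - {e},
      ends = (\<lambda>d. map_uprod (merge_ends G e) (ends G d))\<rparr>"

definition graph_root :: "'e mgraph \<Rightarrow> nat" where
  "graph_root G = Max (verts G)"

definition outdeg :: "'e mgraph \<Rightarrow> nat set \<Rightarrow> nat \<Rightarrow> nat" where
  "outdeg G I i = card {e \<in> edges G. \<exists>j\<in>verts G - I. ends G e = Upair i j}"

text \<open>
  Functions on the vertex set are represented by functions that are \<open>undefined\<close> off the vertex set,
  so that each parking function is counted exactly once.
\<close>

definition parking_functions :: "'e mgraph \<Rightarrow> (nat \<Rightarrow> int) set" where
  "parking_functions G =
     {f \<in> verts G \<rightarrow>\<^sub>E {-1..}.
        f (graph_root G) = -1 \<and>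
        (\<forall>I. I \<noteq> {} \<and> I \<subseteq> verts G - {graph_root G} \<longrightarrow>
           (\<exists>i\<in>I. 0 \<le> f i \<and> f i < int (outdeg G I i)))}"

text \<open>
  Since the root contributes \<open>-1\<close> to the exponent, negative exponents may occur; \<open>q\<close> is a formal
  variable and the enumerator is a (finite) formal Laurent series over the integers.
\<close>

definition parking_enum :: "'e mgraph \<Rightarrow> int fls" where
  "parking_enum G = (\<Sum>f\<in>parking_functions G. fls_X_intpow (\<Sum>i\<in>verts G. f i))"

text \<open>The sum above ranges over a finite set, hence is not zero by convention.\<close>

lemma finite_parking_functions:
  assumes "multigraph G"
  shows "finite (parking_functions G)"
proof (rule finite_subset)
  show "finite (verts G \<rightarrow>\<^sub>E {-1..int (card (edges G))})"
    using assms by (intro finite_PiE) (auto simp: multigraph_def)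
  have bnd: "outdeg G I i \<le> card (edges G)" for I i
    unfolding outdeg_def using assms by (intro card_mono) (auto simp: multigraph_def)
  show "parking_functions G \<subseteq> verts G \<rightarrow>\<^sub>E {-1..int (card (edges G))}"
  proof
    fix f assume f: "f \<in> parking_functions G"
    have "f v \<in> {-1..int (card (edges G))}" if v: "v \<in> verts G" for v
    proof (cases "v = graph_root G")
      case True
      then show ?thesis using f by (simp add: parking_functions_def)
    next
      case False
      then have "\<exists>i\<in>{v}. 0 \<le> f i \<and> f i < int (outdeg G {v} i)"
        using f v unfolding parking_functions_def by blast
      then show ?thesis using bnd[of "{v}" v] by auto
    qed
    then show "f \<in> verts G \<rightarrow>\<^sub>E {-1..int (card (edges G))}"
      using f by (auto simp: parking_functions_def PiE_iff)
  qed
qed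

end

theory Submission
  imports Defs
begin

text \<open>
  When \<open>e\<close> joins the root \<open>r\<close> to another vertex \<open>k\<close>, the parking functions \<open>f\<close> of \<open>G\<close> split
  according to the value at \<open>k\<close>. Removing \<open>e\<close> lowers \<open>outdeg\<^sub>I(k)\<close> by one for every \<open>I\<close> avoiding the
  root and changes no other outdegree of a vertex other than \<open>r\<close>, so lowering \<open>f k\<close> by one turns
  the \<open>f\<close> with \<open>f k \<ge> 1\<close> into the parking functions of \<open>G - e\<close>; this is the term with the factor
  \<open>q\<close>. If \<open>f k = 0\<close>, the edge \<open>e\<close> makes \<open>k\<close> itself satisfy the parking condition for every \<open>I\<close>
  containing \<open>k\<close>, so only the sets \<open>I\<close> avoiding \<open>k\<close> matter, and these give exactly the
  parking condition of the graph in which \<open>k\<close> has been absorbed by the root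
  (\<open>parking_enum_root_edge\<close>).

  For an edge \<open>e\<close> away from the root no such local bijection is apparent. Instead, expand \<open>G\<close>,
  \<open>G - e\<close> and the contraction of \<open>e\<close> along one and the same non-loop \<open>d\<close> at the root. Deletions
  and contractions of \<open>d\<close> and \<open>e\<close> commute, so the identity for \<open>G\<close> and \<open>e\<close> follows from the
  identities for the two graphs obtained by deleting or contracting \<open>d\<close>, which have fewer edges
  (\<open>parking_enum_deletion_contraction\<close>).

  This induction has to pass through disconnected graphs, because \<open>d\<close> may be a bridge. A
  disconnected graph has no parking functions: take for \<open>I\<close> a component without the root. The
  recursion therefore remains true for bridges and for disconnected graphs, and the induction runs
  over all of them. If there is no non-loop at the root to expand along, all three terms vanish (\<open>parking_enum_isolated_root\<close>).
\<close>

section \<open>Ends of edges under deletion and contraction\<close>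

lemma nonloop_ends:
  assumes "\<not> is_loop G e"
  obtains a b where "ends G e = Upair a b" "a < b"
proof -
  obtain x y where xy: "ends G e = Upair x y" by (cases "ends G e") auto
  with assms have "x \<noteq> y" by (auto simp: is_loop_def)
  then show thesis
    using xy that[of x y] that[of y x] by (metis Upair_inject linorder_neqE_nat)
qed

lemma merge_ends_Upair:
  assumes "ends G e = Upair a b" "a < b"
  shows "merge_ends G e = (\<lambda>v. if v = a then b else v)"
  using assms by (auto simp: merge_ends_def fun_eq_iff)

lemma delete_edge_simps [simp]:
  "verts (delete_edge G e) = verts G"
  "edges (delete_edge G e) = edges G - {e}"
  "ends (delete_edge G e) = ends G"
  "graph_root (delete_edge G e) = graph_root G"
  by (simp_all add: delete_edge_def graph_root_def)

lemma contract_edge_simps [simp]: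
  "edges (contract_edge G e) = edges G - {e}"
  "ends (contract_edge G e) = (\<lambda>d. map_uprod (merge_ends G e) (ends G d))"
  by (simp_all add: contract_edge_def)

lemma multigraph_delete_edge: "multigraph G \<Longrightarrow> multigraph (delete_edge G e)"
  by (auto simp: multigraph_def)

lemma multigraph_contract_edge: "multigraph G \<Longrightarrow> multigraph (contract_edge G e)"
  unfolding multigraph_def
proof (intro conjI; elim conjE)
  assume G: "\<forall>v\<in>verts G. 0 < v" "\<forall>e\<in>edges G. set_uprod (ends G e) \<subseteq> verts G"
  obtain a b where ab: "ends G e = Upair a b" by (cases "ends G e") auto
  show "\<forall>v\<in>verts (contract_edge G e). 0 < v"
    using G ab by (auto simp: contract_edge_def merge_ends_def max_def min_def)
qed (auto simp: contract_edge_def uprod.set_map)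

lemma ends_in_verts:
  assumes "multigraph G" "d \<in> edges G" "ends G d = Upair a b"
  shows "a \<in> verts G" "b \<in> verts G"
  using assms by (force simp: multigraph_def)+

lemma le_graph_root: "multigraph G \<Longrightarrow> v \<in> verts G \<Longrightarrow> v \<le> graph_root G"
  by (simp add: multigraph_def graph_root_def)

lemma verts_contract_edge:
  assumes "multigraph G" "e \<in> edges G" "ends G e = Upair a b" "a < b"
  shows "verts (contract_edge G e) = verts G - {a}"
  using assms ends_in_verts[OF assms(1-3)]
  by (auto simp: contract_edge_def merge_ends_Upair[OF assms(3,4)])

lemma graph_root_in_verts:
  assumes "multigraph G" "v \<in> verts G"
  shows "graph_root G \<in> verts G"
  using assms unfolding graph_root_def multigraph_def by (intro Max_in) auto

lemma graph_root_contract_edge: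
  assumes "multigraph G" "e \<in> edges G" "ends G e = Upair a b" "a < b"
  shows "graph_root (contract_edge G e) = graph_root G"
proof -
  note ab = ends_in_verts[OF assms(1-3)]
  have "a \<noteq> graph_root G" using le_graph_root[OF assms(1) ab(2)] assms(4) by simp
  then have "Max (verts G - {a}) = graph_root G"
    using assms(1) graph_root_in_verts[OF assms(1) ab(1)]
    by (intro Max_eqI) (auto simp: multigraph_def graph_root_def)
  then show ?thesis
    unfolding graph_root_def[of "contract_edge G e"] verts_contract_edge[OF assms] .
qed

section \<open>Edges at the root\<close>

lemma parking_function_witness:
  assumes "f \<in> parking_functions G" "I \<noteq> {}" "I \<subseteq> verts G - {graph_root G}"
  obtains i where "i \<in> I" "0 \<le> f i" "f i < int (outdeg G I i)"
proof -
  from assms(1) have "I \<noteq> {} \<and> I \<subseteq> verts G - {graph_root G} \<longrightarrow>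
      (\<exists>i\<in>I. 0 \<le> f i \<and> f i < int (outdeg G I i))"
    unfolding parking_functions_def mem_Collect_eq by (elim conjE) (rule spec)
  with assms(2,3) that show thesis by auto
qed

text \<open>
  The value at \<open>k\<close> records what happens to \<open>e\<close>: a parking function with \<open>f k \<ge> 1\<close> can afford to
  lose the edge together with one unit of \<open>f k\<close>, and one with \<open>f k = 0\<close> carries no information
  at \<open>k\<close>, so \<open>k\<close> can be merged into the root.
\<close>

lemma parking_enum_root_edge:
  assumes G: "multigraph G" and e: "e \<in> edges G"
    and ends: "ends G e = Upair k (graph_root G)" and k: "k \<noteq> graph_root G"
  shows "parking_enum G =
    fls_X * parking_enum (delete_edge G e) + parking_enum (contract_edge G e)"
proof -
  define r where "r = graph_root G"
  define V where "V = verts G"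
  let ?D = "delete_edge G e" and ?C = "contract_edge G e"
  have kV: "k \<in> V" and rV: "r \<in> V" and finV: "finite V" and finE: "finite (edges G)"
    using ends_in_verts[OF G e ends] G by (auto simp: V_def r_def multigraph_def)
  have kr: "k < r" using le_graph_root[OF G] kV k by (auto simp: V_def r_def less_le)
  have ends_r: "ends G e = Upair k r" using ends by (simp add: r_def)
  have VC: "verts ?C = V - {k}"
    using verts_contract_edge[OF G e ends_r kr] by (simp add: V_def)
  have rC: "graph_root ?C = r"
    using graph_root_contract_edge[OF G e ends_r kr] by (simp add: r_def)
  note m = merge_ends_Upair[OF ends_r kr]

  \<comment> \<open>Both operations affect outdegrees only at \<open>k\<close>: the other end \<open>r\<close> of \<open>e\<close> never lies in \<open>I\<close>.\<close>
  have outdeg_k: "outdeg G I k = Suc (outdeg ?D I k)" if "r \<notin> I" for I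
  proof -
    have "{d \<in> edges G. \<exists>j\<in>verts G - I. ends G d = Upair k j} =
      insert e {d \<in> edges ?D. \<exists>j\<in>verts ?D - I. ends ?D d = Upair k j}"
      using that e rV ends_r by (auto simp: V_def)
    then show ?thesis using finE by (simp add: outdeg_def)
  qed
  have outdeg_D: "outdeg ?D I i = outdeg G I i" if "i \<noteq> k" "i \<noteq> r" for I i
    unfolding outdeg_def using that ends_r by (intro arg_cong[of _ _ card]) auto
  have outdeg_C: "outdeg ?C I i = outdeg G I i" if I: "I \<subseteq> V - {k} - {r}" and i: "i \<in> I" for I i
  proof -
    have ik: "i \<noteq> k" "i \<noteq> r" using I i by auto
    have "(\<exists>j\<in>V - {k} - I. map_uprod (merge_ends G e) (ends G d) = Upair i j) \<longleftrightarrow>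
        (\<exists>j\<in>V - I. ends G d = Upair i j)" if d: "d \<in> edges G" for d
    proof -
      obtain x y where xy: "ends G d = Upair x y" by (cases "ends G d") auto
      then have "x \<in> V" "y \<in> V" using ends_in_verts[OF G d xy] by (auto simp: V_def)
      then show ?thesis using ik I rV kr unfolding xy m by (auto split: if_splits)
    qed
    moreover have "\<not> (\<exists>j\<in>V - I. ends G e = Upair i j)" using ik ends_r by auto
    ultimately show ?thesis
      unfolding outdeg_def VC contract_edge_simps V_def[symmetric]
      by (intro arg_cong[of _ _ card]) auto
  qed

  let ?P = "parking_functions G"
  define w where "w = (\<lambda>f. fls_X_intpow (\<Sum>i\<in>V. f i) :: int fls)"
  have nonneg: "0 \<le> f k" if "f \<in> ?P" for f
    by (rule parking_function_witness[OF that, of "{k}"]) (use kV k in \<open>auto simp: V_def\<close>)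
  have finP: "finite ?P" by (rule finite_parking_functions[OF G])

  \<comment> \<open>The witness \<open>i \<in> I\<close> of the parking condition can be kept: for \<open>i = k\<close> both sides of
      \<open>f i < outdeg\<^sub>I(i)\<close> change by one, for any other \<open>i\<close> neither side changes.\<close>
  have pos_part: "(\<Sum>f\<in>{f\<in>?P. 1 \<le> f k}. w f) = fls_X * parking_enum ?D"
  proof -
    have "(\<Sum>f\<in>{f\<in>?P. 1 \<le> f k}. w f) = (\<Sum>f\<in>parking_functions ?D. fls_X * w f)"
    proof (rule sum.reindex_bij_witness[where
          i = "\<lambda>f. f(k := f k + 1)" and j = "\<lambda>f. f(k := f k - 1)"])
      fix f assume f: "f \<in> {f\<in>?P. 1 \<le> f k}"
      show "f(k := f k - 1) \<in> parking_functions ?D"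
        unfolding parking_functions_def
      proof (intro CollectI conjI allI impI)
        fix I assume I: "I \<noteq> {} \<and> I \<subseteq> verts ?D - {graph_root ?D}"
        then obtain i where i: "i \<in> I" "0 \<le> f i" "f i < int (outdeg G I i)"
          using parking_function_witness[of f G I] f by auto
        show "\<exists>i\<in>I. 0 \<le> (f(k := f k - 1)) i \<and> (f(k := f k - 1)) i < int (outdeg ?D I i)"
        proof (intro bexI[of _ i])
          have "r \<notin> I" "i \<noteq> r" using i(1) I by (auto simp: r_def)
          then show "0 \<le> (f(k := f k - 1)) i \<and> (f(k := f k - 1)) i < int (outdeg ?D I i)"
            using i f outdeg_k[of I] outdeg_D[of i I] by (cases "i = k") auto
        qed (rule i)
      qed (use f k kV in \<open>auto simp: parking_functions_def V_def PiE_iff extensional_def\<close>)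
      have "(\<Sum>i\<in>V. f i) = f k + (\<Sum>i\<in>V - {k}. f i)"
        using finV kV by (rule sum.remove)
      moreover have "(\<Sum>i\<in>V. (f(k := f k - 1)) i) = f k - 1 + (\<Sum>i\<in>V - {k}. f i)"
        using finV kV by (subst sum.remove[of _ k]) auto
      ultimately show "fls_X * w (f(k := f k - 1)) = w f"
        by (simp add: w_def fls_X_times_conv_shift)
    next
      fix f assume f: "f \<in> parking_functions ?D"
      have fk: "0 \<le> f k"
        by (rule parking_function_witness[OF f, of "{k}"]) (use kV k in \<open>auto simp: V_def\<close>)
      have "f(k := f k + 1) \<in> ?P"
        unfolding parking_functions_def
      proof (intro CollectI conjI allI impI)
        fix I assume I: "I \<noteq> {} \<and> I \<subseteq> verts G - {graph_root G}"
        then obtain i where i: "i \<in> I" "0 \<le> f i" "f i < int (outdeg ?D I i)"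
          using parking_function_witness[OF f, of I] by auto
        show "\<exists>i\<in>I. 0 \<le> (f(k := f k + 1)) i \<and> (f(k := f k + 1)) i < int (outdeg G I i)"
        proof (intro bexI[of _ i])
          have "r \<notin> I" "i \<noteq> r" using i(1) I by (auto simp: r_def)
          then show "0 \<le> (f(k := f k + 1)) i \<and> (f(k := f k + 1)) i < int (outdeg G I i)"
            using i f outdeg_k[of I] outdeg_D[of i I] by (cases "i = k") auto
        qed (rule i)
      qed (use f k kV fk in \<open>auto simp: parking_functions_def V_def PiE_iff extensional_def\<close>)
      then show "f(k := f k + 1) \<in> {f\<in>?P. 1 \<le> f k}" using fk by simp
    qed auto
    then show ?thesis by (simp add: parking_enum_def sum_distrib_left w_def V_def)
  qed

  \<comment> \<open>Functions on \<open>V - {k}\<close> take the value \<open>undefined\<close> at \<open>k\<close>, so restriction from \<open>V\<close> to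
      \<open>V - {k}\<close> is an update at \<open>k\<close>.\<close>
  have zero_part: "(\<Sum>f\<in>{f\<in>?P. f k = 0}. w f) = parking_enum ?C"
    unfolding parking_enum_def
  proof (rule sum.reindex_bij_witness[where
        i = "\<lambda>f. f(k := 0)" and j = "\<lambda>f. f(k := undefined)"])
    fix f assume f: "f \<in> {f\<in>?P. f k = 0}"
    then show "(f(k := undefined))(k := 0) = f" by auto
    show "f(k := undefined) \<in> parking_functions ?C"
      unfolding parking_functions_def VC rC
    proof (intro CollectI conjI allI impI)
      fix I assume I: "I \<noteq> {} \<and> I \<subseteq> V - {k} - {r}"
      then have "I \<subseteq> verts G - {graph_root G}" by (auto simp: V_def r_def)
      then obtain i where i: "i \<in> I" "0 \<le> f i" "f i < int (outdeg G I i)"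
        using parking_function_witness[of f G I] f I by auto
      then show "\<exists>i\<in>I. 0 \<le> (f(k := undefined)) i \<and>
          (f(k := undefined)) i < int (outdeg ?C I i)"
        using I outdeg_C[of I i] by (intro bexI[of _ i]) auto
    qed (use f kr in \<open>auto simp: parking_functions_def V_def r_def PiE_iff extensional_def\<close>)
    have "(\<Sum>i\<in>V. f i) = (\<Sum>i\<in>V - {k}. f i)"
      using f finV kV by (subst sum.remove[of _ k]) auto
    then show "fls_X_intpow (\<Sum>i\<in>verts ?C. (f(k := undefined)) i) = w f"
      by (simp add: w_def VC)
  next
    fix f assume f: "f \<in> parking_functions ?C"
    then have "f k = undefined"
      by (auto simp: parking_functions_def VC PiE_iff extensional_def)
    then show "(f(k := 0))(k := undefined) = f" by auto
    have "f(k := 0) \<in> ?P"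
      unfolding parking_functions_def V_def[symmetric] r_def[symmetric]
    proof (intro CollectI conjI allI impI)
      fix I assume I: "I \<noteq> {} \<and> I \<subseteq> V - {r}"
      show "\<exists>i\<in>I. 0 \<le> (f(k := 0)) i \<and> (f(k := 0)) i < int (outdeg G I i)"
      proof (cases "k \<in> I")
        case True
        \<comment> \<open>Here \<open>e\<close> leaves \<open>I\<close>, whence \<open>0 < outdeg\<^sub>I(k)\<close>.\<close>
        moreover have "r \<notin> I" using I by auto
        ultimately show ?thesis using outdeg_k[of I] by (intro bexI[of _ k]) auto
      next
        case False
        then have I': "I \<subseteq> V - {k} - {r}" using I by auto
        then obtain i where i: "i \<in> I" "0 \<le> f i" "f i < int (outdeg ?C I i)"
          using parking_function_witness[OF f, of I] I unfolding VC rC by blast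
        then show ?thesis
          using I' False outdeg_C[of I i] by (intro bexI[of _ i]) auto
      qed
    qed (use f kr kV in \<open>auto simp: parking_functions_def VC rC PiE_iff extensional_def\<close>)
    then show "f(k := 0) \<in> {f\<in>?P. f k = 0}" by simp
  qed

  have "?P = {f\<in>?P. 1 \<le> f k} \<union> {f\<in>?P. f k = 0}" using nonneg by force
  then have "parking_enum G = (\<Sum>f\<in>{f\<in>?P. 1 \<le> f k} \<union> {f\<in>?P. f k = 0}. w f)"
    by (simp add: parking_enum_def w_def V_def)
  also have "\<dots> = (\<Sum>f\<in>{f\<in>?P. 1 \<le> f k}. w f) + (\<Sum>f\<in>{f\<in>?P. f k = 0}. w f)"
    using finP by (intro sum.union_disjoint) auto
  finally show ?thesis by (simp add: pos_part zero_part)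
qed

text \<open>
  All non-root vertices together form a set that no edge leaves, so the parking condition fails
  for it.
\<close>

lemma parking_enum_isolated_root:
  assumes v: "v \<in> verts G" "v \<noteq> graph_root G"
    and isolated: "\<And>d k. d \<in> edges G \<Longrightarrow> ends G d = Upair k (graph_root G) \<Longrightarrow> k = graph_root G"
  shows "parking_enum G = 0"
proof -
  let ?I = "verts G - {graph_root G}"
  have no_exit: "outdeg G ?I i = 0" if "i \<in> ?I" for i
  proof -
    have "{d \<in> edges G. \<exists>j\<in>verts G - ?I. ends G d = Upair i j} = {}"
    proof (intro equals0I, elim CollectE conjE bexE)
      fix d j assume d: "d \<in> edges G" "ends G d = Upair i j" and "j \<in> verts G - ?I"
      then have "j = graph_root G" by blast
      with d have "i = graph_root G" using isolated[of d i] by simp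
      with that show False by simp
    qed
    then show ?thesis by (simp only: outdeg_def card.empty)
  qed
  have "parking_functions G = {}"
  proof (intro equals0I)
    fix f assume "f \<in> parking_functions G"
    moreover have "?I \<noteq> {}" using v by auto
    ultimately obtain i where i: "i \<in> ?I" "0 \<le> f i" "f i < int (outdeg G ?I i)"
      by (rule parking_function_witness) simp
    show False using i(2,3) no_exit[OF i(1)] by simp
  qed
  then show ?thesis by (simp add: parking_enum_def)
qed

section \<open>Arbitrary edges\<close>

lemma delete_delete_commute: "delete_edge (delete_edge G d) e = delete_edge (delete_edge G e) d"
proof -
  have "edges G - {d} - {e} = edges G - {e} - {d}" by auto
  then show ?thesis by (simp add: delete_edge_def)
qed

lemma contract_delete_commute: "contract_edge (delete_edge G d) e = delete_edge (contract_edge G e) d"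
proof -
  have "merge_ends (delete_edge G d) e = merge_ends G e"
    by (simp add: merge_ends_def fun_eq_iff)
  then show ?thesis by (simp add: contract_edge_def) (auto simp: delete_edge_def)
qed

text \<open>
  The labels need care when \<open>d\<close> and \<open>e\<close> share an end. Since \<open>r\<close> is larger than both ends of \<open>e\<close>,
  in either order all vertices of the merged class end up with the label \<open>r\<close>; this is what makes
  the two contractions equal and not merely isomorphic.
\<close>

lemma contract_contract_commute:
  assumes d: "ends G d = Upair k r" "k < r"
    and e: "ends G e = Upair a b" "a < b" "b < r"
  shows "contract_edge (contract_edge G d) e = contract_edge (contract_edge G e) d"
proof -
  have "merge_ends (contract_edge G d) e \<circ> merge_ends G d =
      merge_ends (contract_edge G e) d \<circ> merge_ends G e"
    using d e
    by (auto simp: fun_eq_iff merge_ends_Upair[OF d] merge_ends_Upair[OF e(1,2)]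
        merge_ends_def max_def min_def)
  then show ?thesis
    by (auto simp: contract_edge_def image_comp uprod.map_comp)
qed

text \<open>
  Induction on the number of edges. An edge \<open>e\<close> not meeting the root stays a non-loop when an edge
  at the root is contracted, and a non-loop at the root stays one when \<open>e\<close> is contracted; hence all
  four expansions needed are available. Bridges and disconnected graphs are included so that the
  induction hypothesis applies to both graphs obtained from \<open>d\<close>.
\<close>

lemma parking_enum_deletion_contraction:
  assumes "multigraph G" "e \<in> edges G" "\<not> is_loop G e"
  shows "parking_enum G =
    fls_X * parking_enum (delete_edge G e) + parking_enum (contract_edge G e)"
  using assms
proof (induction "card (edges G)" arbitrary: G rule: less_induct)
  case less
  note G = less.prems(1) and e = less.prems(2)
  let ?r = "graph_root G"
  obtain a b where ab: "ends G e = Upair a b" "a < b"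
    using nonloop_ends less.prems(3) by metis
  note abV = ends_in_verts[OF G e ab(1)]
  have br: "b \<le> ?r" using le_graph_root[OF G abV(2)] .
  show ?case
  proof (cases "b = ?r")
    case True
    then show ?thesis using parking_enum_root_edge[OF G e] ab by simp
  next
    case False
    with br have b: "b < ?r" by simp
    note rC = graph_root_contract_edge[OF G e ab]
    show ?thesis
    proof (cases "\<exists>d\<in>edges G. \<exists>k. ends G d = Upair k ?r \<and> k \<noteq> ?r")
      case True
      then obtain d k where d: "d \<in> edges G" and k: "ends G d = Upair k ?r" "k \<noteq> ?r" by blast
      have kr: "k < ?r"
        using le_graph_root[OF G ends_in_verts(1)[OF G d k(1)]] k(2) by simp
      have de: "d \<noteq> e" using k(1) ab b by auto
      have fewer: "card (edges G - {d}) < card (edges G)"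
        using G d by (intro card_Diff1_less) (auto simp: multigraph_def)
      let ?D = "delete_edge G d" and ?C = "contract_edge G d"
      have D: "parking_enum ?D =
          fls_X * parking_enum (delete_edge ?D e) + parking_enum (contract_edge ?D e)"
        using fewer e de less.prems(3) multigraph_delete_edge[OF G]
        by (intro less.hyps) (auto simp: is_loop_def)
      have "\<not> is_loop ?C e"
        using ab b kr by (auto simp: is_loop_def merge_ends_Upair[OF k(1) kr])
      then have C: "parking_enum ?C =
          fls_X * parking_enum (delete_edge ?C e) + parking_enum (contract_edge ?C e)"
        using fewer e de multigraph_contract_edge[OF G] by (intro less.hyps) auto
      have 1: "parking_enum G = fls_X * parking_enum ?D + parking_enum ?C"
        using parking_enum_root_edge[OF G d k] .
      have 2: "parking_enum (delete_edge G e) =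
          fls_X * parking_enum (delete_edge (delete_edge G e) d)
          + parking_enum (contract_edge (delete_edge G e) d)"
        using d de k by (intro parking_enum_root_edge multigraph_delete_edge G) auto
      have "\<exists>k'. ends (contract_edge G e) d = Upair k' ?r \<and> k' \<noteq> ?r"
        using k ab b by (auto simp: merge_ends_Upair[OF ab])
      then have 3: "parking_enum (contract_edge G e) =
          fls_X * parking_enum (delete_edge (contract_edge G e) d)
          + parking_enum (contract_edge (contract_edge G e) d)"
        using d de multigraph_contract_edge[OF G, of e] rC
        by (metis parking_enum_root_edge contract_edge_simps(1) DiffI singletonD)
      show ?thesis
        unfolding 1 2 3 D C contract_contract_commute[OF k(1) kr ab b]
          delete_delete_commute[of G d e] contract_delete_commute
        by (simp add: algebra_simps)
    next
      case False
      have "parking_enum G = 0"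
        using abV b False by (intro parking_enum_isolated_root[of b]) auto
      moreover have "parking_enum (delete_edge G e) = 0"
        using abV b False by (intro parking_enum_isolated_root[of b]) auto
      moreover have "parking_enum (contract_edge G e) = 0"
      proof (rule parking_enum_isolated_root[of b])
        show "b \<in> verts (contract_edge G e)"
          using abV ab by (simp add: verts_contract_edge[OF G e ab])
        show "b \<noteq> graph_root (contract_edge G e)" using b rC by simp
        fix d k assume d: "d \<in> edges (contract_edge G e)"
          and k: "ends (contract_edge G e) d = Upair k (graph_root (contract_edge G e))"
        obtain x y where xy: "ends G d = Upair x y" by (cases "ends G d") auto
        have "x = ?r \<longleftrightarrow> y = ?r"
          using d False xy by auto
        then show "k = graph_root (contract_edge G e)"
          using k xy b ab(2) unfolding rC
          by (simp add: merge_ends_Upair[OF ab] split: if_splits) auto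
      qed
      ultimately show ?thesis by simp
    qed
  qed
qed

theorem theorem4p1:
  fixes G :: "'e mgraph" and n :: nat and e :: 'e
  assumes "multigraph G"
    and "connected_graph G"
    and "verts G = {1..n}"
    and "e \<in> edges G"
    and "\<not> is_loop G e"
    and "\<not> is_bridge G e"
  shows "parking_enum G = fls_X * parking_enum (delete_edge G e) + parking_enum (contract_edge G e)"
  using assms(1,4,5) by (rule parking_enum_deletion_contraction)

end
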